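(* Let $\mathcal{E}_{\mathtt{RS}} = \mathcal{E}_1 \cup \{\mathrm{RS}, \mathrm{RSP1}, \mathrm{RSP2}, \mathrm{EL2}\}$. For all closed $\mathrm{BCCSP}_{\|}$ terms $p,q$: if $\mathcal{E}_{\mathtt{RS}}\vdash p\approx q$ then $p\sim_{\mathtt{RS}} q$.
   Context: Let $\mathcal{A}$ be a finite non-empty set of actions and $\mathcal{V}$ a countably infinite set of variables. $\mathrm{BCCSP}_{\|}$ terms: $t ::= \mathbf{0} \mid x \mid a.t \mid t+t \mid t \,\|\, t$ ($a\in\mathcal{A}$, $x \in \mathcal{V}$; $ax$ means $a.x$). Closed terms are processes. Transitions: $a.p \xrightarrow{a} p$; if $p \xrightarrow{a} p'$ then $p+q \xrightarrow{a} p'$, $q+p \xrightarrow{a} p'$, $p\|q \xrightarrow{a} p'\|q$, $q \| p \xrightarrow{a} q \| p'$. $\mathtt{I}(p)=\{a\mid\exists p'.\,p\xrightarrow{a}p'\}$. A ready simulation is a relation $R$ on processes such that $pRq$ implies $\mathtt{I}(p)=\mathtt{I}(q)$, and $pRq$, $p\xrightarrow{a}p'$ imply $q\xrightarrow{a}q'$ with $p'Rq'$ for some $q'$. $p\sqsubseteq_{\mathtt{RS}}q$ iff $pRq$ for some ready simulation $R$; $p\sim_{\mathtt{RS}}q$ iff $p\sqsubseteq_{\mathtt{RS}}q$ and $q\sqsubseteq_{\mathtt{RS}}p$. $\mathcal{E}\vdash t\approx u$: derivable in equational logic (reflexivity, symmetry, transitivity, substitution instances of axioms, closure under $a.\_$,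 $+$, $\|$). Axioms with concrete action names stand for all instances with actions from $\mathcal{A}$. $\mathcal{E}_1$: A0 $x+\mathbf{0}\approx x$; A1 $x+y\approx y+x$; A2 $(x+y)+z \approx x+(y+z)$; A3 $x+x\approx x$; P0 $x\|\mathbf{0}\approx x$; P1 $x\|y \approx y \| x$. RS: $a(bx+by+z)\approx a(bx+by+z)+a(bx+z)$. RSP1: $(ax+ay+u)\|(bz+bw+v) \approx (ax+u)\|(bz+bw+v) + (ay+u)\|(bz+bw+v) + (ax+ay+u)\|(bz+v) + (ax+ay+u)\|(bw+v)$. RSP2: $(\sum_{i\in I} a_i x_i)\|(by+bz+w) \approx (\sum_{i\in I} a_ix_i)\|(by+w) + (\sum_{i\in I} a_ix_i)\|(bz+w) + \sum_{i\in I} a_i(x_i \| (by+bz+w))$, $I$ finite, $a_j\neq a_k$ for $j\neq k$. EL2: $\sum_{i\in I} a_ix_i \| \sum_{j\in J} b_jy_j \approx \sum_{i\in I} a_i(x_i \| \sum_{j\in J} b_j y_j) + \sum_{j\in J} b_j(\sum_{i\in I} a_i x_i \| y_j)$, $I,J$ finite, the $a_i$ pairwise distinct and the $b_j$ pairwise distinct. *)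

theory Defs
  imports Main
begin

text \<open>The type \<^typ>\<open>'a\<close> is the set of actions. It is non-empty like every type; no definition here
  needs it to be finite, so theorems about a finite action set add the sort \<^class>\<open>finite\<close>.\<close>

datatype 'a bccsp =
    Zero  ("\<zero>")
  | Var nat
  | Pre 'a "'a bccsp"  (infixr "\<cdot>" 75)
  | Plus "'a bccsp" "'a bccsp"  (infixl "\<oplus>" 65)
  | Par "'a bccsp" "'a bccsp"  (infixl "\<parallel>" 70)

primrec vars :: "'a bccsp \<Rightarrow> nat set" where
  "vars \<zero> = {}"
| "vars (Var x) = {x}"
| "vars (a \<cdot> t) = vars t"
| "vars (t \<oplus> u) = vars t \<union> vars u"
| "vars (t \<parallel> u) = vars t \<union> vars u"

definition closed_term :: "'a bccsp \<Rightarrow> bool" where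
  "closed_term t \<longleftrightarrow> vars t = {}"

primrec subst :: "(nat \<Rightarrow> 'a bccsp) \<Rightarrow> 'a bccsp \<Rightarrow> 'a bccsp" where
  "subst \<sigma> \<zero> = \<zero>"
| "subst \<sigma> (Var x) = \<sigma> x"
| "subst \<sigma> (a \<cdot> t) = a \<cdot> subst \<sigma> t"
| "subst \<sigma> (t \<oplus> u) = subst \<sigma> t \<oplus> subst \<sigma> u"
| "subst \<sigma> (t \<parallel> u) = subst \<sigma> t \<parallel> subst \<sigma> u"

text \<open>The rules are stated for all terms, with no rule for variables. Closed terms only reach
  closed terms, so on processes this is the usual transition relation.\<close>

inductive step :: "'a bccsp \<Rightarrow> 'a \<Rightarrow> 'a bccsp \<Rightarrow> bool"  ("_ \<midarrow>_\<rightarrow> _" [61, 0, 61] 60) where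
  pre: "a \<cdot> p \<midarrow>a\<rightarrow> p"
| plusL: "p \<midarrow>a\<rightarrow> p' \<Longrightarrow> p \<oplus> q \<midarrow>a\<rightarrow> p'"
| plusR: "p \<midarrow>a\<rightarrow> p' \<Longrightarrow> q \<oplus> p \<midarrow>a\<rightarrow> p'"
| parL: "p \<midarrow>a\<rightarrow> p' \<Longrightarrow> p \<parallel> q \<midarrow>a\<rightarrow> p' \<parallel> q"
| parR: "p \<midarrow>a\<rightarrow> p' \<Longrightarrow> q \<parallel> p \<midarrow>a\<rightarrow> q \<parallel> p'"

definition initials :: "'a bccsp \<Rightarrow> 'a set" where
  "initials p = {a. \<exists>p'. p \<midarrow>a\<rightarrow> p'}"

definition ready_simulation :: "('a bccsp \<Rightarrow> 'a bccsp \<Rightarrow> bool) \<Rightarrow> bool" where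
  "ready_simulation R \<longleftrightarrow>
     (\<forall>p q. R p q \<longrightarrow> closed_term p \<and> closed_term q) \<and>
     (\<forall>p q. R p q \<longrightarrow> initials p = initials q) \<and>
     (\<forall>p q a p'. R p q \<and> p \<midarrow>a\<rightarrow> p' \<longrightarrow> (\<exists>q'. q \<midarrow>a\<rightarrow> q' \<and> R p' q'))"

definition rs_le :: "'a bccsp \<Rightarrow> 'a bccsp \<Rightarrow> bool"  (infix "\<sqsubseteq>\<^sub>R\<^sub>S" 50) where
  "p \<sqsubseteq>\<^sub>R\<^sub>S q \<longleftrightarrow> (\<exists>R. ready_simulation R \<and> R p q)"

definition rs_eq :: "'a bccsp \<Rightarrow> 'a bccsp \<Rightarrow> bool"  (infix "\<sim>\<^sub>R\<^sub>S" 50) where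
  "p \<sim>\<^sub>R\<^sub>S q \<longleftrightarrow> p \<sqsubseteq>\<^sub>R\<^sub>S q \<and> q \<sqsubseteq>\<^sub>R\<^sub>S p"

inductive derivable :: "('a bccsp \<times> 'a bccsp) set \<Rightarrow> 'a bccsp \<Rightarrow> 'a bccsp \<Rightarrow> bool"
    ("_ \<turnstile> _ \<approx> _" [51, 51, 51] 50) for E where
  refl: "E \<turnstile> t \<approx> t"
| sym: "E \<turnstile> t \<approx> u \<Longrightarrow> E \<turnstile> u \<approx> t"
| trans: "E \<turnstile> t \<approx> u \<Longrightarrow> E \<turnstile> u \<approx> v \<Longrightarrow> E \<turnstile> t \<approx> v"
| axiom: "(t, u) \<in> E \<Longrightarrow> E \<turnstile> subst \<sigma> t \<approx> subst \<sigma> u"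
| cong_pre: "E \<turnstile> t \<approx> u \<Longrightarrow> E \<turnstile> a \<cdot> t \<approx> a \<cdot> u"
| cong_plus: "E \<turnstile> t \<approx> u \<Longrightarrow> E \<turnstile> t' \<approx> u' \<Longrightarrow> E \<turnstile> t \<oplus> t' \<approx> u \<oplus> u'"
| cong_par: "E \<turnstile> t \<approx> u \<Longrightarrow> E \<turnstile> t' \<approx> u' \<Longrightarrow> E \<turnstile> t \<parallel> t' \<approx> u \<parallel> u'"

text \<open>An axiom is included for every choice of pairwise distinct names of its variables; as
  \<^const>\<open>derivable\<close> uses all substitution instances, one choice would yield the same theory.\<close>

definition ax_A0 :: "('a bccsp \<times> 'a bccsp) set" where
  "ax_A0 = {(Var x \<oplus> \<zero>, Var x) | x. True}"

definition ax_A1 :: "('a bccsp \<times> 'a bccsp) set" where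
  "ax_A1 = {(Var x \<oplus> Var y, Var y \<oplus> Var x) | x y. distinct [x, y]}"

definition ax_A2 :: "('a bccsp \<times> 'a bccsp) set" where
  "ax_A2 = {((Var x \<oplus> Var y) \<oplus> Var z, Var x \<oplus> (Var y \<oplus> Var z)) | x y z. distinct [x, y, z]}"

definition ax_A3 :: "('a bccsp \<times> 'a bccsp) set" where
  "ax_A3 = {(Var x \<oplus> Var x, Var x) | x. True}"

definition ax_P0 :: "('a bccsp \<times> 'a bccsp) set" where
  "ax_P0 = {(Var x \<parallel> \<zero>, Var x) | x. True}"

definition ax_P1 :: "('a bccsp \<times> 'a bccsp) set" where
  "ax_P1 = {(Var x \<parallel> Var y, Var y \<parallel> Var x) | x y. distinct [x, y]}"

definition E1 :: "('a bccsp \<times> 'a bccsp) set" where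
  "E1 = ax_A0 \<union> ax_A1 \<union> ax_A2 \<union> ax_A3 \<union> ax_P0 \<union> ax_P1"

definition ax_RS :: "('a bccsp \<times> 'a bccsp) set" where
  "ax_RS = {(a \<cdot> (b \<cdot> Var x \<oplus> b \<cdot> Var y \<oplus> Var z),
             a \<cdot> (b \<cdot> Var x \<oplus> b \<cdot> Var y \<oplus> Var z) \<oplus> a \<cdot> (b \<cdot> Var x \<oplus> Var z))
            | a b x y z. distinct [x, y, z]}"

definition ax_RSP1 :: "('a bccsp \<times> 'a bccsp) set" where
  "ax_RSP1 =
    {((a \<cdot> Var x \<oplus> a \<cdot> Var y \<oplus> Var u) \<parallel> (b \<cdot> Var z \<oplus> b \<cdot> Var w \<oplus> Var v),
        (a \<cdot> Var x \<oplus> Var u) \<parallel> (b \<cdot> Var z \<oplus> b \<cdot> Var w \<oplus> Var v)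
      \<oplus> (a \<cdot> Var y \<oplus> Var u) \<parallel> (b \<cdot> Var z \<oplus> b \<cdot> Var w \<oplus> Var v)
      \<oplus> (a \<cdot> Var x \<oplus> a \<cdot> Var y \<oplus> Var u) \<parallel> (b \<cdot> Var z \<oplus> Var v)
      \<oplus> (a \<cdot> Var x \<oplus> a \<cdot> Var y \<oplus> Var u) \<parallel> (b \<cdot> Var w \<oplus> Var v))
     | a b x y u z w v. distinct [x, y, u, z, w, v]}"

text \<open>The empty sum is \<^term>\<open>\<zero>\<close>, and a one-element sum is its only summand.\<close>

fun bigsum :: "'a bccsp list \<Rightarrow> 'a bccsp" where
  "bigsum [] = \<zero>"
| "bigsum [t] = t"
| "bigsum (t # u # ts) = t \<oplus> bigsum (u # ts)"

text \<open>A finite family of pairs of an action \<open>a\<^sub>i\<close> and a variable \<open>x\<^sub>i\<close> is given by a list \<open>s\<close>.\<close>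

definition ax_RSP2 :: "('a bccsp \<times> 'a bccsp) set" where
  "ax_RSP2 =
    {(bigsum [a \<cdot> Var x. (a, x) \<leftarrow> s] \<parallel> (b \<cdot> Var y \<oplus> b \<cdot> Var z \<oplus> Var w),
        bigsum [a \<cdot> Var x. (a, x) \<leftarrow> s] \<parallel> (b \<cdot> Var y \<oplus> Var w)
      \<oplus> bigsum [a \<cdot> Var x. (a, x) \<leftarrow> s] \<parallel> (b \<cdot> Var z \<oplus> Var w)
      \<oplus> bigsum [a \<cdot> (Var x \<parallel> (b \<cdot> Var y \<oplus> b \<cdot> Var z \<oplus> Var w)). (a, x) \<leftarrow> s])
     | s b y z w. distinct (map fst s) \<and> distinct (map snd s @ [y, z, w])}"

definition ax_EL2 :: "('a bccsp \<times> 'a bccsp) set" where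
  "ax_EL2 =
    {(bigsum [a \<cdot> Var x. (a, x) \<leftarrow> s] \<parallel> bigsum [b \<cdot> Var y. (b, y) \<leftarrow> r],
        bigsum [a \<cdot> (Var x \<parallel> bigsum [b \<cdot> Var y. (b, y) \<leftarrow> r]). (a, x) \<leftarrow> s]
      \<oplus> bigsum [b \<cdot> (bigsum [a \<cdot> Var x. (a, x) \<leftarrow> s] \<parallel> Var y). (b, y) \<leftarrow> r])
     | s r. distinct (map fst s) \<and> distinct (map fst r) \<and> distinct (map snd s @ map snd r)}"

definition E_RS :: "('a bccsp \<times> 'a bccsp) set" where
  "E_RS = E1 \<union> ax_RS \<union> ax_RSP1 \<union> ax_RSP2 \<union> ax_EL2"

end

theory Submission
  imports Defs
begin

text \<open>Ready similarity extends to open terms by letting variables deadlock. The extended relation is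
  a precongruence, and both sides of every substitution instance of an axiom have the same initials
  and can match each other's steps up to the preorder. The key inequality is
  \<open>b\<cdot>x \<oplus> z \<sqsubseteq> b\<cdot>x \<oplus> b\<cdot>y \<oplus> z\<close>, which holds because the two terms have the same initials. So open
  terms in a derivation need no special treatment, and restricting the relation to closed terms
  yields a ready simulation.\<close>

lemma step_simps [simp]:
  "\<not> \<zero> \<midarrow>a\<rightarrow> v"
  "b \<cdot> t \<midarrow>a\<rightarrow> v \<longleftrightarrow> a = b \<and> v = t"
  "t \<oplus> u \<midarrow>a\<rightarrow> v \<longleftrightarrow> t \<midarrow>a\<rightarrow> v \<or> u \<midarrow>a\<rightarrow> v"
  "t \<parallel> u \<midarrow>a\<rightarrow> v \<longleftrightarrow> (\<exists>t'. t \<midarrow>a\<rightarrow> t' \<and> v = t' \<parallel> u) \<or> (\<exists>u'. u \<midarrow>a\<rightarrow> u' \<and> v = t \<parallel> u')"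
  by (auto intro: step.intros elim: step.cases)

lemma initials_simps [simp]:
  "initials \<zero> = {}"
  "initials (a \<cdot> t) = {a}"
  "initials (t \<oplus> u) = initials t \<union> initials u"
  "initials (t \<parallel> u) = initials t \<union> initials u"
  by (auto simp: initials_def)

lemma step_bigsum: "bigsum ts \<midarrow>a\<rightarrow> v \<longleftrightarrow> (\<exists>t\<in>set ts. t \<midarrow>a\<rightarrow> v)"
  by (induction ts rule: bigsum.induct) auto

lemma initials_bigsum [simp]: "initials (bigsum ts) = (\<Union>t\<in>set ts. initials t)"
  by (auto simp: initials_def step_bigsum)

text \<open>A general \<open>f\<close> lets one rule cover the plain sums and the sums whose
  continuations are parallel compositions, as in RSP2 and EL2.\<close>

lemma step_bigsum_pre [simp]:
  "bigsum [a \<cdot> f x. (a, x) \<leftarrow> s] \<midarrow>c\<rightarrow> v \<longleftrightarrow> (\<exists>x. (c, x) \<in> set s \<and> v = f x)"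
  by (force simp: step_bigsum)

lemma subst_bigsum [simp]: "subst \<sigma> (bigsum ts) = bigsum (map (subst \<sigma>) ts)"
  by (induction ts rule: bigsum.induct) auto

lemma closed_step: "p \<midarrow>a\<rightarrow> p' \<Longrightarrow> closed_term p \<Longrightarrow> closed_term p'"
  by (induction rule: step.induct) (auto simp: closed_term_def)

text \<open>Taken as a greatest fixed point, so that coinduction replaces the explicit choice of a
  ready simulation.\<close>

coinductive open_rs_le :: "'a bccsp \<Rightarrow> 'a bccsp \<Rightarrow> bool"  (infix "\<sqsubseteq>" 50) where
  open_rs_leI: "initials p = initials q \<Longrightarrow>
    (\<And>a p'. p \<midarrow>a\<rightarrow> p' \<Longrightarrow> \<exists>q'. q \<midarrow>a\<rightarrow> q' \<and> p' \<sqsubseteq> q') \<Longrightarrow> p \<sqsubseteq> q"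

lemma open_rs_le_initials: "p \<sqsubseteq> q \<Longrightarrow> initials p = initials q"
  by (auto elim: open_rs_le.cases)

lemma open_rs_le_step: "p \<sqsubseteq> q \<Longrightarrow> p \<midarrow>a\<rightarrow> p' \<Longrightarrow> \<exists>q'. q \<midarrow>a\<rightarrow> q' \<and> p' \<sqsubseteq> q'"
  by (auto elim: open_rs_le.cases)

lemma open_rs_le_refl [simp]: "p \<sqsubseteq> p"
  by (coinduction arbitrary: p) auto

text \<open>Each step is matched by the identical step, and reflexivity relates the targets.
  Inclusion of steps yields only one inclusion between the initials, so their equality is a separate
  assumption.\<close>

lemma open_rs_le_of_steps:
  assumes "initials p = initials q" "\<And>a r. p \<midarrow>a\<rightarrow> r \<Longrightarrow> q \<midarrow>a\<rightarrow> r"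
  shows "p \<sqsubseteq> q"
  by (rule open_rs_leI) (use assms open_rs_le_refl in blast)+

lemma open_rs_le_trans: "p \<sqsubseteq> q \<Longrightarrow> q \<sqsubseteq> r \<Longrightarrow> p \<sqsubseteq> r"
proof (coinduction arbitrary: p q r)
  case open_rs_le
  then have "initials p = initials r" by (simp add: open_rs_le_initials)
  moreover have "\<exists>r' q'. r \<midarrow>a\<rightarrow> r' \<and> p' \<sqsubseteq> q' \<and> q' \<sqsubseteq> r'" if "p \<midarrow>a\<rightarrow> p'" for a p'
    using open_rs_le open_rs_le_step that by meson
  ultimately show ?case by (metis (lifting))
qed

text \<open>Prefix, like choice below, disappears after one step, so a single unfolding suffices.
  Parallel composition persists and requires coinduction.\<close>

lemma open_rs_le_pre: "p \<sqsubseteq> q \<Longrightarrow> a \<cdot> p \<sqsubseteq> a \<cdot> q"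
  by (rule open_rs_leI) auto

lemma open_rs_le_plus: "p \<sqsubseteq> q \<Longrightarrow> p' \<sqsubseteq> q' \<Longrightarrow> p \<oplus> p' \<sqsubseteq> q \<oplus> q'"
  by (rule open_rs_leI) (simp add: open_rs_le_initials, metis open_rs_le_step step_simps(3))

lemma open_rs_le_par: "p \<sqsubseteq> q \<Longrightarrow> p' \<sqsubseteq> q' \<Longrightarrow> p \<parallel> p' \<sqsubseteq> q \<parallel> q'"
proof (coinduction arbitrary: p q p' q')
  case open_rs_le
  then have "initials (p \<parallel> p') = initials (q \<parallel> q')" by (simp add: open_rs_le_initials)
  \<comment> \<open>The candidate relation pairs compositions whose components are related. The
    component that moves is matched; the idle one keeps its hypothesis.\<close>
  moreover have "\<exists>u. q \<parallel> q' \<midarrow>a\<rightarrow> u \<and>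
      (\<exists>r s r' s'. t = r \<parallel> r' \<and> u = s \<parallel> s' \<and> r \<sqsubseteq> s \<and> r' \<sqsubseteq> s')"
    if "p \<parallel> p' \<midarrow>a\<rightarrow> t" for a t
    using that[unfolded step_simps]
  proof (elim disjE exE conjE)
    fix r assume "p \<midarrow>a\<rightarrow> r" "t = r \<parallel> p'"
    moreover from this obtain s where "q \<midarrow>a\<rightarrow> s" "r \<sqsubseteq> s"
      using open_rs_le open_rs_le_step by meson
    ultimately show ?thesis using open_rs_le by (blast intro: step.parL)
  next
    fix r assume "p' \<midarrow>a\<rightarrow> r" "t = p \<parallel> r"
    moreover from this obtain s where "q' \<midarrow>a\<rightarrow> s" "r \<sqsubseteq> s"
      using open_rs_le open_rs_le_step by meson
    ultimately show ?thesis using open_rs_le by (blast intro: step.parR)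
  qed
  ultimately show ?case by (metis (lifting))
qed

lemma open_rs_le_par_zero: "p \<parallel> \<zero> \<sqsubseteq> p" "p \<sqsubseteq> p \<parallel> \<zero>"
  by (coinduction arbitrary: p; auto)+

lemma open_rs_le_par_commute: "p \<parallel> q \<sqsubseteq> q \<parallel> p"
  by (coinduction arbitrary: p q) auto

text \<open>The remaining \<open>b\<close> summand still offers \<open>b\<close>, so dropping the
  other one leaves the initials unchanged.\<close>

lemma open_rs_le_choice:
  "b \<cdot> x \<oplus> z \<sqsubseteq> b \<cdot> x \<oplus> b \<cdot> y \<oplus> z"
  "b \<cdot> y \<oplus> z \<sqsubseteq> b \<cdot> x \<oplus> b \<cdot> y \<oplus> z"
  by (rule open_rs_leI; auto)+

text \<open>The added summand can only move to \<open>b \<cdot> x \<oplus> z\<close>, which lies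
  below the target of \<open>P\<close> by \<open>open_rs_le_choice\<close>.\<close>

lemma open_rs_eq_RS:
  defines "P a b x y z \<equiv> a \<cdot> (b \<cdot> x \<oplus> b \<cdot> y \<oplus> z)"
  shows "P a b x y z \<sqsubseteq> P a b x y z \<oplus> a \<cdot> (b \<cdot> x \<oplus> z)"
    "P a b x y z \<oplus> a \<cdot> (b \<cdot> x \<oplus> z) \<sqsubseteq> P a b x y z"
  unfolding P_def by (rule open_rs_leI; auto intro: open_rs_le_choice)+

text \<open>Each step of \<open>P \<parallel> Q\<close> is literally a step of some summand of
  \<open>R\<close>, since a moving component leaves the other whole. Conversely, each summand lies
  below \<open>P \<parallel> Q\<close> by precongruence.\<close>

lemma open_rs_eq_RSP1:
  fixes a b x y u z w v
  defines "P \<equiv> a \<cdot> x \<oplus> a \<cdot> y \<oplus> u" and "Q \<equiv> b \<cdot> z \<oplus> b \<cdot> w \<oplus> v"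
  defines "R \<equiv> (a \<cdot> x \<oplus> u) \<parallel> Q \<oplus> (a \<cdot> y \<oplus> u) \<parallel> Q \<oplus> P \<parallel> (b \<cdot> z \<oplus> v) \<oplus> P \<parallel> (b \<cdot> w \<oplus> v)"
  shows "P \<parallel> Q \<sqsubseteq> R" "R \<sqsubseteq> P \<parallel> Q"
proof -
  have I: "initials (P \<parallel> Q) = initials R"
    by (auto simp: P_def Q_def R_def)
  show "P \<parallel> Q \<sqsubseteq> R"
    by (rule open_rs_le_of_steps[OF I]) (auto simp: P_def Q_def R_def)
  have "a \<cdot> x \<oplus> u \<sqsubseteq> P" "a \<cdot> y \<oplus> u \<sqsubseteq> P" "b \<cdot> z \<oplus> v \<sqsubseteq> Q" "b \<cdot> w \<oplus> v \<sqsubseteq> Q"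
    unfolding P_def Q_def by (rule open_rs_le_choice)+
  \<comment> \<open>One copy of \<open>P \<parallel> Q\<close> bounds each of the four summands;
    idempotence of choice then merges the copies.\<close>
  then have "R \<sqsubseteq> P \<parallel> Q \<oplus> P \<parallel> Q \<oplus> P \<parallel> Q \<oplus> P \<parallel> Q"
    unfolding R_def by (intro open_rs_le_plus open_rs_le_par) auto
  moreover have "P \<parallel> Q \<oplus> P \<parallel> Q \<oplus> P \<parallel> Q \<oplus> P \<parallel> Q \<sqsubseteq> P \<parallel> Q"
    by (rule open_rs_le_of_steps) auto
  ultimately show "R \<sqsubseteq> P \<parallel> Q" by (rule open_rs_le_trans)
qed

text \<open>Steps of \<open>Q\<close> appear in the first two summands of \<open>R\<close>; steps of
  \<open>S\<close>, which must leave \<open>Q\<close> whole, appear in the third.\<close>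

lemma open_rs_eq_RSP2:
  fixes s b y z w
  defines "S \<equiv> bigsum [a \<cdot> x. (a, x) \<leftarrow> s]" and "Q \<equiv> b \<cdot> y \<oplus> b \<cdot> z \<oplus> w"
  defines "R \<equiv> S \<parallel> (b \<cdot> y \<oplus> w) \<oplus> S \<parallel> (b \<cdot> z \<oplus> w) \<oplus> bigsum [a \<cdot> (x \<parallel> Q). (a, x) \<leftarrow> s]"
  shows "S \<parallel> Q \<sqsubseteq> R" "R \<sqsubseteq> S \<parallel> Q"
proof -
  have I: "initials (S \<parallel> Q) = initials R"
    by (auto simp: S_def Q_def R_def)
  show "S \<parallel> Q \<sqsubseteq> R"
  proof (rule open_rs_le_of_steps[OF I])
    fix c t assume "S \<parallel> Q \<midarrow>c\<rightarrow> t"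
    then show "R \<midarrow>c\<rightarrow> t"
      unfolding R_def by (auto simp: S_def Q_def)
  qed
  \<comment> \<open>The third summand is matched by identical steps, the first two only up to the
    preorder.\<close>
  have "bigsum [a \<cdot> (x \<parallel> Q). (a, x) \<leftarrow> s] \<midarrow>c\<rightarrow> t \<Longrightarrow> S \<parallel> Q \<midarrow>c\<rightarrow> t" for c t
    unfolding S_def by auto
  moreover have "S \<parallel> (b \<cdot> y \<oplus> w) \<sqsubseteq> S \<parallel> Q" "S \<parallel> (b \<cdot> z \<oplus> w) \<sqsubseteq> S \<parallel> Q"
    unfolding Q_def by (intro open_rs_le_par open_rs_le_refl open_rs_le_choice)+
  ultimately have "\<exists>t'. S \<parallel> Q \<midarrow>c\<rightarrow> t' \<and> t \<sqsubseteq> t'" if "R \<midarrow>c\<rightarrow> t" for c t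
    using that unfolding R_def step_simps(3)
    by (meson open_rs_le_step open_rs_le_refl)
  then show "R \<sqsubseteq> S \<parallel> Q" by (rule open_rs_leI[OF I[symmetric]])
qed

text \<open>This is the expansion law: both sides have the same steps to the same targets.\<close>

lemma open_rs_eq_EL2:
  fixes s r
  defines "S \<equiv> bigsum [a \<cdot> x. (a, x) \<leftarrow> s]" and "Q \<equiv> bigsum [b \<cdot> y. (b, y) \<leftarrow> r]"
  defines "R \<equiv> bigsum [a \<cdot> (x \<parallel> Q). (a, x) \<leftarrow> s] \<oplus> bigsum [b \<cdot> (S \<parallel> y). (b, y) \<leftarrow> r]"
  shows "S \<parallel> Q \<sqsubseteq> R" "R \<sqsubseteq> S \<parallel> Q"
proof -
  have I: "initials (S \<parallel> Q) = initials R"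
    by (auto simp: S_def Q_def R_def)
  have "S \<parallel> Q \<midarrow>c\<rightarrow> t \<longleftrightarrow> R \<midarrow>c\<rightarrow> t" for c t
    unfolding R_def by (auto simp: S_def Q_def)
  then show "S \<parallel> Q \<sqsubseteq> R" "R \<sqsubseteq> S \<parallel> Q"
    by (auto intro!: open_rs_le_of_steps simp: I simp del: initials_simps step_simps)
qed

lemma axiom_open_rs_eq:
  assumes "(t, u) \<in> E_RS"
  shows "subst \<sigma> t \<sqsubseteq> subst \<sigma> u \<and> subst \<sigma> u \<sqsubseteq> subst \<sigma> t"
proof -
  \<comment> \<open>The choice axioms have identical steps on both sides. P0 and P1 change the shape
    of the targets and rely on the coinductive lemmas.\<close>
  consider "(t, u) \<in> ax_A0 \<union> ax_A1 \<union> ax_A2 \<union> ax_A3" | "(t, u) \<in> ax_P0" | "(t, u) \<in> ax_P1"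
    | "(t, u) \<in> ax_RS" | "(t, u) \<in> ax_RSP1" | "(t, u) \<in> ax_RSP2" | "(t, u) \<in> ax_EL2"
    using assms unfolding E_RS_def E1_def by blast
  then show ?thesis
  proof cases
    case 1
    then have "initials (subst \<sigma> t) = initials (subst \<sigma> u)"
      and "subst \<sigma> t \<midarrow>a\<rightarrow> v \<longleftrightarrow> subst \<sigma> u \<midarrow>a\<rightarrow> v" for a v
      by (auto simp: ax_A0_def ax_A1_def ax_A2_def ax_A3_def)
    then show ?thesis by (metis open_rs_le_of_steps)
  next
    case 2
    then show ?thesis by (auto simp: ax_P0_def open_rs_le_par_zero)
  next
    case 3
    then show ?thesis by (auto simp: ax_P1_def open_rs_le_par_commute)
  next
    case 4
    then show ?thesis by (auto simp: ax_RS_def open_rs_eq_RS)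
  next
    case 5
    then show ?thesis by (auto simp: ax_RSP1_def open_rs_eq_RSP1)
  next
    case 6
    then obtain s b y z w where
      t: "t = bigsum [a \<cdot> Var x. (a, x) \<leftarrow> s] \<parallel> (b \<cdot> Var y \<oplus> b \<cdot> Var z \<oplus> Var w)" and
      u: "u = bigsum [a \<cdot> Var x. (a, x) \<leftarrow> s] \<parallel> (b \<cdot> Var y \<oplus> Var w)
        \<oplus> bigsum [a \<cdot> Var x. (a, x) \<leftarrow> s] \<parallel> (b \<cdot> Var z \<oplus> Var w)
        \<oplus> bigsum [a \<cdot> (Var x \<parallel> (b \<cdot> Var y \<oplus> b \<cdot> Var z \<oplus> Var w)). (a, x) \<leftarrow> s]"
      unfolding ax_RSP2_def by blast
    show ?thesis
      \<comment> \<open>Mapping \<sigma> over the second components turns the family of variables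
        into the substituted family of terms and keeps the actions.\<close>
      using open_rs_eq_RSP2[where s = "map (map_prod id \<sigma>) s" and b = b
          and y = "\<sigma> y" and z = "\<sigma> z" and w = "\<sigma> w"]
      by (simp add: t u comp_def case_prod_beta)
  next
    case 7
    then obtain s r where
      t: "t = bigsum [a \<cdot> Var x. (a, x) \<leftarrow> s] \<parallel> bigsum [b \<cdot> Var y. (b, y) \<leftarrow> r]" and
      u: "u = bigsum [a \<cdot> (Var x \<parallel> bigsum [b \<cdot> Var y. (b, y) \<leftarrow> r]). (a, x) \<leftarrow> s]
        \<oplus> bigsum [b \<cdot> (bigsum [a \<cdot> Var x. (a, x) \<leftarrow> s] \<parallel> Var y). (b, y) \<leftarrow> r]"
      unfolding ax_EL2_def by blast
    show ?thesis
      using open_rs_eq_EL2[where s = "map (map_prod id \<sigma>) s"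
          and r = "map (map_prod id \<sigma>) r"]
      by (simp add: t u comp_def case_prod_beta)
  qed
qed

text \<open>Both directions are proved together because symmetry exchanges them. Transitivity may
  pass through open terms even between closed ones.\<close>

lemma derivable_open_rs_eq: "E_RS \<turnstile> t \<approx> u \<Longrightarrow> t \<sqsubseteq> u \<and> u \<sqsubseteq> t"
proof (induction rule: derivable.induct)
  case axiom
  then show ?case by (rule axiom_open_rs_eq)
qed (auto intro: open_rs_le_trans open_rs_le_pre open_rs_le_plus open_rs_le_par)

lemma open_rs_le_imp_rs_le:
  assumes "p \<sqsubseteq> q" "closed_term p" "closed_term q"
  shows "p \<sqsubseteq>\<^sub>R\<^sub>S q"
proof -
  have "ready_simulation (\<lambda>p q. p \<sqsubseteq> q \<and> closed_term p \<and> closed_term q)"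
    unfolding ready_simulation_def
  proof (intro conjI allI impI; (elim conjE)?)
    fix p q a p' assume H: "p \<sqsubseteq> q" "closed_term p" "closed_term q" "p \<midarrow>a\<rightarrow> p'"
    from open_rs_le_step[OF H(1,4)] obtain q' where q': "q \<midarrow>a\<rightarrow> q'" "p' \<sqsubseteq> q'"
      by auto
    \<comment> \<open>Transitions preserve closedness, so the matched targets stay in the restricted
      relation.\<close>
    with closed_step[OF H(4,2)] closed_step[OF q'(1) H(3)]
    show "\<exists>q'. q \<midarrow>a\<rightarrow> q' \<and> p' \<sqsubseteq> q' \<and> closed_term p' \<and> closed_term q'"
      by auto
  qed (simp_all add: open_rs_le_initials)
  then show ?thesis using assms unfolding rs_le_def by blast
qed

theorem theorem3p2:
  fixes p q :: "'a::finite bccsp"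
  assumes "closed_term p" and "closed_term q"
    and "E_RS \<turnstile> p \<approx> q"
  shows "p \<sim>\<^sub>R\<^sub>S q"
  using derivable_open_rs_eq[OF assms(3)] assms(1,2) unfolding rs_eq_def
  by (auto intro: open_rs_le_imp_rs_le)

end
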